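(* Let $d$ be a non-negative integer, let $G=(V,E)$ be a $d$-manifold (a finite simple graph, in the discrete sense), and let $\psi: V\to\mathbb{C}$ be a complex-valued function. Then, for every $c\in\mathbb{C}$ with $c\notin\psi(V)$, the level surface $\{\psi=c\}$ is a $(d-2)$-manifold or empty.
   Context: All graphs are finite simple graphs. For a vertex $v$ of a graph $G=(V,E)$, the unit sphere $S(v)$ is the sub-graph of $G$ induced by the set of vertices adjacent to $v$, and $G-v$ is the graph obtained by deleting $v$ and all edges at $v$. The following notions are defined by induction. - Contractible: the one-vertex graph is contractible; a graph $G$ is contractible if for some vertex $v$ both $S(v)$ and $G-v$ are contractible. - $d$-manifold: $G$ is a $d$-manifold if every unit sphere $S(v)$, $v\in V$, is a $(d-1)$-sphere. - $d$-sphere: the empty graph is the $(-1)$-sphere; for $d\ge 0$, a $d$-sphere is a $d$-manifold $G$ such that $G-v$ is contractible for some vertex $v$. A simplex of $G$ is a non-empty set of pairwise adjacent vertices (the vertex set of a complete sub-graph); a triangle is a simplex with three vertices. The Barycentric refinement $G_1$ of $G$ is the graph whose vertices are the simplices of $G$, two distinct simplices being adjacent if one is contained in the other. For real $t$, $\mathrm{sign}(t)\in\{-1,0,1\}$ is the usual sign, and $\mathrm{sign}(a+ib)=\mathrm{sign}(a)+i\,\mathrm{sign}(b)$ for real $a,b$. Level surface: for $\psi:V\to\mathbb{C}$ and $c\in\mathbb{C}$, $\{\psi=c\}$ is the sub-graph of $G_1$ induced by those simplices of $G$ which contain (possibly equal) a triangle $x$ such that (i) $v\mapsto \mathrm{sign}(\psi(v)-c)$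 takes at least $3$ different values on the vertices of $x$, and (ii) the set of these values includes both $-1+i$ and $1-i$. *)

theory Defs
  imports Complex_Main "Graph_Theory.Digraph_Component" "Graph_Theory.Pair_Digraph"
begin

text \<open>
  A finite simple graph is a digraph satisfying the locale predicate \<^const>\<open>graph\<close>: finite,
  symmetric, without loops and without parallel arcs. An undirected edge is thus a pair of
  opposite arcs. The predicates below are only meaningful for such graphs; this property
  is inherited by all the graphs constructed here, as the lemmas show.
\<close>

definition unit_sphere :: "('a, 'b) pre_digraph \<Rightarrow> 'a \<Rightarrow> ('a, 'b) pre_digraph" where
  "unit_sphere G v = G \<restriction> {w. v \<rightarrow>\<^bsub>G\<^esub> w}"

inductive contractible_graph :: "('a, 'b) pre_digraph \<Rightarrow> bool" where
  one_vertex: "verts G = {v} \<Longrightarrow> contractible_graph G"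
| extend: "v \<in> verts G \<Longrightarrow> contractible_graph (unit_sphere G v) \<Longrightarrow>
    contractible_graph (pre_digraph.del_vert G v) \<Longrightarrow> contractible_graph G"

text \<open>
  The dimension is an integer, so that the empty graph can be the sphere of dimension \<open>-1\<close>.
  There are no spheres of dimension below \<open>-1\<close>; hence in negative dimensions
  only the empty graph is a manifold, as it is (vacuously) in every dimension.
\<close>

inductive d_manifold :: "int \<Rightarrow> ('a, 'b) pre_digraph \<Rightarrow> bool"
  and d_sphere :: "int \<Rightarrow> ('a, 'b) pre_digraph \<Rightarrow> bool" where
  manifold: "(\<And>v. v \<in> verts G \<Longrightarrow> d_sphere (d - 1) (unit_sphere G v)) \<Longrightarrow> d_manifold d G"
| empty_sphere: "verts G = {} \<Longrightarrow> d_sphere (-1) G"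
| sphere: "d \<ge> 0 \<Longrightarrow> d_manifold d G \<Longrightarrow> v \<in> verts G \<Longrightarrow>
    contractible_graph (pre_digraph.del_vert G v) \<Longrightarrow> d_sphere d G"

definition simplex :: "('a, 'b) pre_digraph \<Rightarrow> 'a set \<Rightarrow> bool" where
  "simplex G x \<longleftrightarrow> x \<noteq> {} \<and> x \<subseteq> verts G \<and> (\<forall>u\<in>x. \<forall>v\<in>x. u \<noteq> v \<longrightarrow> u \<rightarrow>\<^bsub>G\<^esub> v)"

definition triangle :: "('a, 'b) pre_digraph \<Rightarrow> 'a set \<Rightarrow> bool" where
  "triangle G x \<longleftrightarrow> simplex G x \<and> card x = 3"

definition barycentric_refinement ::
    "('a, 'b) pre_digraph \<Rightarrow> ('a set, 'a set \<times> 'a set) pre_digraph" where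
  "barycentric_refinement G = with_proj
    \<lparr> pverts = {x. simplex G x},
      parcs = {(x, y). simplex G x \<and> simplex G y \<and> (x \<subset> y \<or> y \<subset> x)} \<rparr>"

text \<open>This is not \<^const>\<open>sgn\<close> on the complex numbers, which is \<open>z / norm z\<close>.\<close>

definition csign :: "complex \<Rightarrow> complex" where
  "csign z = Complex (sgn (Re z)) (sgn (Im z))"

definition level_surface ::
    "('a, 'b) pre_digraph \<Rightarrow> ('a \<Rightarrow> complex) \<Rightarrow> complex \<Rightarrow>
      ('a set, 'a set \<times> 'a set) pre_digraph" where
  "level_surface G \<psi> c = barycentric_refinement G \<restriction>
    {y. simplex G y \<and>
      (\<exists>x. x \<subseteq> y \<and> triangle G x \<and>
        card ((\<lambda>v. csign (\<psi> v - c)) ` x) \<ge> 3 \<and>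
        {-1 + \<i>, 1 - \<i>} \<subseteq> (\<lambda>v. csign (\<psi> v - c)) ` x)}"

lemma graph_induce_subgraph:
  assumes "graph G" "S \<subseteq> verts G"
  shows "graph (G \<restriction> S)"
proof -
  interpret G: graph G by fact
  interpret H: wf_digraph "G \<restriction> S" by (rule G.wellformed_induce_subgraph)
  show ?thesis
  proof
    show "finite (verts (G \<restriction> S))" "finite (arcs (G \<restriction> S))"
      using finite_subset[OF assms(2) G.finite_verts] by simp_all
    show "\<And>e. e \<in> arcs (G \<restriction> S) \<Longrightarrow> tail (G \<restriction> S) e \<noteq> head (G \<restriction> S) e"
      using G.no_loops by simp
    show "\<And>e1 e2. e1 \<in> arcs (G \<restriction> S) \<Longrightarrow> e2 \<in> arcs (G \<restriction> S) \<Longrightarrow>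
        arc_to_ends (G \<restriction> S) e1 = arc_to_ends (G \<restriction> S) e2 \<Longrightarrow> e1 = e2"
      using G.no_multi_arcs by (simp add: arc_to_ends_def)
    have *: "arcs_ends (G \<restriction> S) = arcs_ends G \<inter> S \<times> S"
      by (auto simp: arcs_ends_def arc_to_ends_def)
    have "sym (arcs_ends G)"
      using G.sym_arcs by (simp add: symmetric_def)
    then show "symmetric (G \<restriction> S)"
      unfolding symmetric_def * by (auto simp: sym_def)
  qed
qed

lemma graph_unit_sphere: "graph G \<Longrightarrow> graph (unit_sphere G v)"
  unfolding unit_sphere_def
  by (rule graph_induce_subgraph)
    (auto dest: wf_digraph.adj_in_verts[OF fin_digraph.axioms(1), rotated]
      simp: graph_def digraph_def)

lemma del_vert_eq_induce_subgraph:
  "graph G \<Longrightarrow> pre_digraph.del_vert G v = G \<restriction> (verts G - {v})"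
  unfolding pre_digraph.del_vert_def induce_subgraph_def
  by (auto simp: graph_def digraph_def fin_digraph_def wf_digraph_def)

lemma graph_del_vert: "graph G \<Longrightarrow> graph (pre_digraph.del_vert G v)"
  by (simp add: del_vert_eq_induce_subgraph graph_induce_subgraph)

lemma graph_barycentric_refinement:
  assumes "graph G"
  shows "graph (barycentric_refinement G)"
proof -
  interpret G: graph G by fact
  let ?V = "{x. simplex G x}"
  have fin: "finite ?V"
    by (rule finite_subset[of _ "Pow (verts G)"]) (auto simp: simplex_def)
  have "pair_graph \<lparr> pverts = ?V,
      parcs = {(x, y). simplex G x \<and> simplex G y \<and> (x \<subset> y \<or> y \<subset> x)} \<rparr>"
  proof
    show "finite (parcs \<lparr> pverts = ?V,
      parcs = {(x, y). simplex G x \<and> simplex G y \<and> (x \<subset> y \<or> y \<subset> x)} \<rparr>)"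
      by (rule finite_subset[of _ "?V \<times> ?V"]) (auto simp: fin)
  qed (auto simp: fin symmetric_def sym_def)
  then show ?thesis
    unfolding barycentric_refinement_def by (rule pair_graph.pair_graphD_graph)
qed

lemma graph_level_surface: "graph G \<Longrightarrow> graph (level_surface G \<psi> c)"
  unfolding level_surface_def
  by (rule graph_induce_subgraph[OF graph_barycentric_refinement])
    (auto simp: barycentric_refinement_def)

end

theory Submission
  imports Defs
begin

text \<open>
  Only three kinds of sign matter for the level surface: \<open>-1 + \<i>\<close>, \<open>1 - \<i>\<close> and everything else.
  Colour each vertex by its kind. A simplex contains a triangle with at least three signs, the
  two named ones among them, exactly when all three colours occur on it
  (\<open>contains_crossing_triangle_iff\<close>). So the level surface consists of the simplices that carry
  all three colours, ordered by inclusion, and the theorem is a case of the following statement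
  about an arbitrary colouring \<open>f\<close> of an \<open>n\<close>-manifold on which \<open>k\<close> colours occur: the simplices
  that carry all \<open>k\<close> colours form an \<open>(n + 1 - k)\<close>-manifold (\<open>manifold_colourful_simplices\<close>).
  If one of the three colours does not occur on the graph, the level surface is empty.

  The unit sphere of such a simplex \<open>y\<close> is the join of the part above \<open>y\<close> and the part below it,
  since anything below \<open>y\<close> is comparable to anything above.

  \<^item> Every simplex above \<open>y\<close> carries all the colours, so the upper part is the barycentric
    refinement of the link of \<open>y\<close>. The link is a sphere of dimension \<open>n - card y\<close>
    (\<open>sphere_link\<close>), and refinement keeps spheres spheres (\<open>sphere_simplices\<close>).
  \<^item> The lower part depends only on how the colours are distributed over \<open>y\<close>: it is the refined
    boundary of a product of \<open>k\<close> simplices, one for each colour class, and hence a sphere of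
    dimension \<open>card y - k - 1\<close> (\<open>sphere_colourful_below\<close>).

  The join of a \<open>p\<close>-sphere and a \<open>q\<close>-sphere is a \<open>(p + q + 1)\<close>-sphere (\<open>sphere_join\<close>), so the
  dimensions add up to \<open>n - k\<close>, one less than that of the manifold. Contractibility has two
  sources: a contraction of a graph carries over to joins and to refinements
  (\<open>contractible_join\<close>, \<open>contractible_simplices\<close>), and a vertex dominated by a neighbour can be
  removed, because its unit sphere is a cone (\<open>contractible_dominated\<close>).
\<close>

section \<open>Contractible sets, spheres and manifolds inside a fixed adjacency relation\<close>

text \<open>
  All the graphs in the argument are induced subgraphs of two fixed relations: adjacency in the
  given graph, and comparability of sets. The notions are therefore restated for a vertex set
  inside a fixed relation \<open>E\<close>, so that unit spheres, deletions and joins become set operations.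
\<close>

definition nbrs :: "('a \<Rightarrow> 'a \<Rightarrow> bool) \<Rightarrow> 'a set \<Rightarrow> 'a \<Rightarrow> 'a set" where
  "nbrs E V v = {w \<in> V. E v w}"

inductive contractible :: "('a \<Rightarrow> 'a \<Rightarrow> bool) \<Rightarrow> 'a set \<Rightarrow> bool" for E where
  point: "contractible E {v}"
| extend: "v \<in> V \<Longrightarrow> contractible E (nbrs E V v) \<Longrightarrow> contractible E (V - {v}) \<Longrightarrow> contractible E V"

inductive sphere :: "('a \<Rightarrow> 'a \<Rightarrow> bool) \<Rightarrow> int \<Rightarrow> 'a set \<Rightarrow> bool" for E where
  empty: "sphere E (-1) {}"
| nonempty: "n \<ge> 0 \<Longrightarrow> (\<And>v. v \<in> V \<Longrightarrow> sphere E (n - 1) (nbrs E V v)) \<Longrightarrow> v \<in> V \<Longrightarrow>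
    contractible E (V - {v}) \<Longrightarrow> sphere E n V"

definition manifold :: "('a \<Rightarrow> 'a \<Rightarrow> bool) \<Rightarrow> int \<Rightarrow> 'a set \<Rightarrow> bool" where
  "manifold E n V \<longleftrightarrow> (\<forall>v \<in> V. sphere E (n - 1) (nbrs E V v))"

lemma contractible_finite: "contractible E V \<Longrightarrow> finite V"
  by (induction rule: contractible.induct) auto

lemma sphere_finite: "sphere E n V \<Longrightarrow> finite V"
  by (induction rule: sphere.induct) (auto dest: contractible_finite)

lemma sphere_manifold: "sphere E n V \<Longrightarrow> manifold E n V"
  by (induction rule: sphere.cases) (auto simp: manifold_def)

lemma nbrs_image:
  assumes "v \<in> V" "\<And>a b. a \<in> V \<Longrightarrow> b \<in> V \<Longrightarrow> E' (h a) (h b) \<longleftrightarrow> E a b"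
  shows "nbrs E' (h ` V) (h v) = h ` nbrs E V v"
  using assms by (auto simp: nbrs_def)

lemma contractible_image:
  assumes "contractible E V" "inj_on h V" "\<And>a b. a \<in> V \<Longrightarrow> b \<in> V \<Longrightarrow> E' (h a) (h b) \<longleftrightarrow> E a b"
  shows "contractible E' (h ` V)"
  using assms
proof (induction rule: contractible.induct)
  case (point v)
  show ?case using contractible.point[of E' "h v"] by simp
next
  case (extend v V)
  have *: "nbrs E V v \<subseteq> V" by (auto simp: nbrs_def)
  have "contractible E' (h ` nbrs E V v)"
    using extend.prems * by (intro extend.IH(1)) (auto intro: inj_on_subset)
  then have "contractible E' (nbrs E' (h ` V) (h v))"
    using nbrs_image[of v V E' h E] extend.hyps(1) extend.prems(2) by simp
  moreover have "contractible E' (h ` (V - {v}))"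
    using extend.prems by (intro extend.IH(2)) (auto intro: inj_on_subset)
  then have "contractible E' (h ` V - {h v})"
    using inj_on_image_set_diff[OF extend.prems(1), of V "{v}"] extend.hyps(1) by simp
  ultimately show ?case
    using contractible.extend[of "h v" "h ` V"] extend.hyps(1) by blast
qed

lemma sphere_image:
  assumes "sphere E n V" "inj_on h V" "\<And>a b. a \<in> V \<Longrightarrow> b \<in> V \<Longrightarrow> E' (h a) (h b) \<longleftrightarrow> E a b"
  shows "sphere E' n (h ` V)"
  using assms
proof (induction rule: sphere.induct)
  case empty
  show ?case by (simp add: sphere.empty)
next
  case (nonempty n V v)
  show ?case
  proof (rule sphere.nonempty)
    show "sphere E' (n - 1) (nbrs E' (h ` V) u')" if "u' \<in> h ` V" for u'
    proof -
      from that obtain u where u: "u \<in> V" "u' = h u" by auto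
      have *: "nbrs E V u \<subseteq> V" by (auto simp: nbrs_def)
      have "sphere E' (n - 1) (h ` nbrs E V u)"
        using nonempty.prems * u by (intro nonempty.IH) (auto intro: inj_on_subset)
      then show ?thesis using nbrs_image[of u V E' h E] u nonempty.prems(2) by simp
    qed
    have "contractible E' (h ` (V - {v}))"
      using nonempty.prems
      by (intro contractible_image[OF nonempty.hyps(4)]) (auto intro: inj_on_subset)
    then show "contractible E' (h ` V - {h v})"
      using inj_on_image_set_diff[OF nonempty.prems(1), of V "{v}"] nonempty.hyps(3) by simp
  qed (use nonempty.hyps in auto)
qed

text \<open>
  Symmetry lets cones and joins be entered from either side; irreflexivity makes unit spheres
  and links proper subsets, on which the inductions over the vertex set rest.
\<close>

locale adjacency =
  fixes E :: "'a \<Rightarrow> 'a \<Rightarrow> bool"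
  assumes sym: "E a b \<Longrightarrow> E b a"
    and irrefl: "\<not> E a a"
begin

text \<open>
  Removing a point of the base, and passing to its unit sphere, both leave a cone over a smaller
  base with the same apex.
\<close>

lemma contractible_cone:
  assumes "finite B" "\<And>b. b \<in> B \<Longrightarrow> E a b"
  shows "contractible E (insert a B)"
  using assms
proof (induction B rule: finite_psubset_induct)
  case (psubset B)
  show ?case
  proof (cases "B = {}")
    case True
    then show ?thesis by (simp add: contractible.point)
  next
    case False
    then obtain b where b: "b \<in> B" by auto
    have "nbrs E B b \<subset> B" using b irrefl by (auto simp: nbrs_def)
    then have "contractible E (insert a (nbrs E B b))"
      using psubset.prems by (intro psubset.IH) auto
    also have "insert a (nbrs E B b) = nbrs E (insert a B) b"
      using psubset.prems[OF b] sym by (auto simp: nbrs_def)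
    finally have 1: "contractible E (nbrs E (insert a B) b)" .
    have "contractible E (insert a (B - {b}))"
      using psubset.prems b by (intro psubset.IH) auto
    also have "insert a (B - {b}) = insert a B - {b}"
      using psubset.prems[OF b] irrefl by auto
    finally have "contractible E (insert a B - {b})" .
    with 1 b show ?thesis using contractible.extend[of b "insert a B"] by blast
  qed
qed

text \<open>
  A contraction of one factor works in the join: unit spheres and deletions of its
  vertices are joined with \<open>B\<close> throughout, and the last remaining vertex gives a cone over \<open>B\<close>.
\<close>

lemma contractible_join:
  assumes "contractible E A" "finite B" "\<And>a b. a \<in> A \<Longrightarrow> b \<in> B \<Longrightarrow> E a b"
  shows "contractible E (A \<union> B)"
  using assms
proof (induction rule: contractible.induct)
  case (point v)
  then show ?case using contractible_cone[of B v] by simp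
next
  case (extend v A)
  have "nbrs E (A \<union> B) v = nbrs E A v \<union> B" "A \<union> B - {v} = (A - {v}) \<union> B"
    using extend.prems(2) extend.hyps(1) irrefl by (auto simp: nbrs_def)
  moreover have "contractible E (nbrs E A v \<union> B)"
    using extend.prems by (intro extend.IH(1)) (auto simp: nbrs_def)
  moreover have "contractible E ((A - {v}) \<union> B)"
    using extend.prems by (intro extend.IH(2)) auto
  ultimately show ?case
    using extend.hyps(1) contractible.extend[of v "A \<union> B"] by (metis UnI1)
qed

text \<open>
  A vertex of either factor has as unit sphere the join of its unit sphere in that factor with
  the whole other factor. The induction is therefore nested: over \<open>A\<close> for all \<open>B\<close>, and within it
  over \<open>B\<close> for the fixed \<open>A\<close>.
\<close>

lemma sphere_join:
  assumes "sphere E n A" "sphere E m B" "\<And>a b. a \<in> A \<Longrightarrow> b \<in> B \<Longrightarrow> E a b"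
  shows "sphere E (n + m + 1) (A \<union> B)"
  using assms
proof (induction arbitrary: m B rule: sphere.induct)
  case empty
  then show ?case by simp
next
  case (nonempty n A v)
  note A = nonempty.hyps and IH_A = nonempty.IH
  from nonempty.prems show ?case
  proof (induction rule: sphere.induct)
    case empty
    then show ?case using sphere.nonempty[OF A] by simp
  next
    case (nonempty m B w)
    have B: "sphere E m B" using nonempty.hyps by (rule sphere.nonempty)
    show ?case
    proof (rule sphere.nonempty)
      show "sphere E (n + m + 1 - 1) (nbrs E (A \<union> B) u)" if "u \<in> A \<union> B" for u
      proof (cases "u \<in> A")
        case True
        have "sphere E (n - 1 + m + 1) (nbrs E A u \<union> B)"
          using True B nonempty.prems by (intro IH_A) (auto simp: nbrs_def)
        moreover have "nbrs E (A \<union> B) u = nbrs E A u \<union> B"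
          using True nonempty.prems by (auto simp: nbrs_def)
        ultimately show ?thesis by simp
      next
        case False
        then have u: "u \<in> B" using that by simp
        have "sphere E (n + (m - 1) + 1) (A \<union> nbrs E B u)"
          using u nonempty.prems by (intro nonempty.IH) (auto simp: nbrs_def)
        moreover have "nbrs E (A \<union> B) u = A \<union> nbrs E B u"
          using u nonempty.prems sym by (auto simp: nbrs_def)
        ultimately show ?thesis by simp
      qed
      have "contractible E ((A - {v}) \<union> B)"
        using A(4) sphere_finite[OF B] nonempty.prems by (intro contractible_join) auto
      moreover have "(A - {v}) \<union> B = A \<union> B - {v}"
        using A(3) nonempty.prems irrefl by auto
      ultimately show "contractible E (A \<union> B - {v})" by simp
    qed (use A nonempty.hyps in auto)
  qed
qed

text \<open>
  The points of \<open>R\<close> are attached to \<open>X\<close> in the order of their rank \<open>g\<close>. At the moment when \<open>r\<close> is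
  attached, all its present neighbours are also neighbours of \<open>p r\<close>, so its unit sphere is a cone
  with apex \<open>p r\<close>. That is why domination within \<open>R\<close> is demanded only towards ranks not above
  that of \<open>r\<close>.
\<close>

lemma contractible_dominated:
  fixes g :: "'a \<Rightarrow> int"
  assumes "finite R" "contractible E X" "X \<inter> R = {}"
    and "\<And>r. r \<in> R \<Longrightarrow> p r \<in> X \<and> E r (p r)"
    and "\<And>r w. r \<in> R \<Longrightarrow> w \<in> X \<Longrightarrow> E r w \<Longrightarrow> w \<noteq> p r \<Longrightarrow> E (p r) w"
    and "\<And>r s. r \<in> R \<Longrightarrow> s \<in> R \<Longrightarrow> g s \<le> g r \<Longrightarrow> E r s \<Longrightarrow> E (p r) s"
  shows "contractible E (X \<union> R)"
  using assms(1,3-)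
proof (induction R rule: finite_ranking_induct[where f = g])
  case empty
  then show ?case using assms(2) by simp
next
  case (insert r R)
  show ?case
  proof (cases "r \<in> R")
    case True
    then show ?thesis using insert by (simp add: insert_absorb)
  next
    case False
    have pr: "p r \<in> X" "E r (p r)" using insert.prems(2)[of r] by auto
    let ?N = "nbrs E (X \<union> insert r R) r"
    have "E (p r) w" if "w \<in> ?N - {p r}" for w
      using that insert.prems(3)[of r w] insert.prems(4)[of r w] insert.hyps(2)[of w] irrefl
      by (auto simp: nbrs_def)
    note dominated = this
    have "finite (?N - {p r})"
      using insert.hyps(1) contractible_finite[OF assms(2)] by (simp add: nbrs_def)
    then have "contractible E (insert (p r) (?N - {p r}))"
      using dominated by (rule contractible_cone)
    moreover have "insert (p r) (?N - {p r}) = ?N"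
      using pr by (auto simp: nbrs_def)
    ultimately have "contractible E ?N" by simp
    moreover have "contractible E (X \<union> R)"
      using insert.prems by (intro insert.IH) auto
    moreover have "X \<union> insert r R - {r} = X \<union> R"
      using False insert.prems(1) by auto
    ultimately show ?thesis
      using contractible.extend[of r "X \<union> insert r R"] by simp
  qed
qed

definition link :: "'a set \<Rightarrow> 'a set \<Rightarrow> 'a set" where
  "link V x = {w \<in> V. \<forall>u \<in> x. E u w}"

text \<open>
  Adding a vertex to \<open>x\<close> passes from the link to a unit sphere inside it, which lowers the
  dimension by one.
\<close>

lemma sphere_link:
  assumes "manifold E n V" "finite x" "x \<noteq> {}" "x \<subseteq> V" "pairwise E x"
  shows "sphere E (n - int (card x)) (link V x)"
  using assms(2-)
proof (induction x rule: finite_ne_induct)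
  case (singleton v)
  then show ?case using assms(1) by (simp add: manifold_def link_def nbrs_def)
next
  case (insert v x)
  have "v \<in> link V x"
    using insert.prems insert.hyps by (auto simp: link_def pairwise_def)
  moreover have "sphere E (n - int (card x)) (link V x)"
    using insert.prems by (intro insert.IH) (auto simp: pairwise_insert)
  ultimately have "sphere E (n - int (card x) - 1) (nbrs E (link V x) v)"
    using sphere_manifold unfolding manifold_def by blast
  moreover have "nbrs E (link V x) v = link V (insert v x)"
    by (auto simp: nbrs_def link_def)
  ultimately show ?case using insert.hyps by (simp add: algebra_simps)
qed

end

section \<open>Families of sets under comparability\<close>

text \<open>
  Barycentric refinements are families of sets under this relation. They are contracted by
  inserting one element into all members of a family, or by removing one from all of them.
\<close>

definition comparable :: "'a set \<Rightarrow> 'a set \<Rightarrow> bool" where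
  "comparable x y \<longleftrightarrow> x \<subset> y \<or> y \<subset> x"

interpretation comparable: adjacency comparable
  by unfold_locales (auto simp: comparable_def)

text \<open>
  A set without \<open>v\<close> is dominated by the set with \<open>v\<close> inserted, once larger sets without \<open>v\<close> are
  left out; hence sets are attached in the order of increasing size.
\<close>

lemma contractible_insert_closed:
  assumes "\<And>x. x \<in> F \<Longrightarrow> finite x" "finite F" "\<And>x. x \<in> F \<Longrightarrow> insert v x \<in> F"
    and "contractible comparable {x \<in> F. v \<in> x}"
  shows "contractible comparable F"
proof -
  have card: "\<not> r \<subset> s" if "s \<in> F" "card s \<le> card r" for r s
    using that psubset_card_mono[OF assms(1)[of s], of r] by auto
  have "contractible comparable ({x \<in> F. v \<in> x} \<union> {x \<in> F. v \<notin> x})"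
  proof (rule comparable.contractible_dominated[where p = "insert v" and g = "\<lambda>x. int (card x)"])
    show "comparable (insert v r) s"
      if "r \<in> {x \<in> F. v \<notin> x}" "s \<in> {x \<in> F. v \<notin> x}" "int (card s) \<le> int (card r)" "comparable r s"
      for r s
      using that card[of s r] by (auto simp: comparable_def)
  qed (use assms in \<open>auto simp: comparable_def\<close>)
  moreover have "{x \<in> F. v \<in> x} \<union> {x \<in> F. v \<notin> x} = F" by auto
  ultimately show ?thesis by simp
qed

text \<open>
  The dual of the previous lemma: \<open>x - {v}\<close> dominates \<open>x\<close> as long as smaller sets containing \<open>v\<close>
  are left out, so the larger sets are attached first.
\<close>

lemma contractible_remove_closed:
  assumes "\<And>x. x \<in> F \<Longrightarrow> finite x" "finite F" "\<And>x. x \<in> F \<Longrightarrow> x - {v} \<in> F"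
    and "contractible comparable {x \<in> F. v \<notin> x}"
  shows "contractible comparable F"
proof -
  have card: "\<not> s \<subset> r" if "r \<in> F" "card r \<le> card s" for r s
    using that psubset_card_mono[OF assms(1)[of r], of s] by auto
  have "contractible comparable ({x \<in> F. v \<notin> x} \<union> {x \<in> F. v \<in> x})"
  proof (rule comparable.contractible_dominated[where p = "\<lambda>x. x - {v}" and g = "\<lambda>x. - int (card x)"])
    show "comparable (r - {v}) s"
      if "r \<in> {x \<in> F. v \<in> x}" "s \<in> {x \<in> F. v \<in> x}" "- int (card s) \<le> - int (card r)" "comparable r s"
      for r s
      using that card[of r s] by (auto simp: comparable_def)
  qed (use assms in \<open>auto simp: comparable_def\<close>)
  moreover have "{x \<in> F. v \<notin> x} \<union> {x \<in> F. v \<in> x} = F" by auto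
  ultimately show ?thesis by simp
qed

text \<open>
  The simplices above \<open>x\<close> arise by adding \<open>x\<close> to sets disjoint from it. This is an isomorphism
  of comparability relations, which carries contractibility and spheres along.
\<close>

lemma union_image_comparable:
  assumes "\<And>a. a \<in> F \<Longrightarrow> a \<inter> x = {}"
  shows inj_on_union_image: "inj_on ((\<union>) x) F"
    and comparable_union_iff:
      "a \<in> F \<Longrightarrow> b \<in> F \<Longrightarrow> comparable (x \<union> a) (x \<union> b) \<longleftrightarrow> comparable a b"
proof -
  \<comment> \<open>disjointness lets \<open>x\<close> be cancelled\<close>
  have *: "x \<union> a \<subseteq> x \<union> b \<longleftrightarrow> a \<subseteq> b" if "a \<in> F" for a b
    using assms[OF that] by auto
  show "inj_on ((\<union>) x) F"
    by (rule inj_onI) (metis * subset_antisym subset_refl)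
  show "a \<in> F \<Longrightarrow> b \<in> F \<Longrightarrow> comparable (x \<union> a) (x \<union> b) \<longleftrightarrow> comparable a b"
    unfolding comparable_def less_le_not_le using *[of a b] *[of b a] by auto
qed

lemma contractible_union_image:
  assumes "contractible comparable F" "\<And>a. a \<in> F \<Longrightarrow> a \<inter> x = {}"
  shows "contractible comparable ((\<union>) x ` F)"
  by (rule contractible_image[OF assms(1) inj_on_union_image[OF assms(2)]
        comparable_union_iff[OF assms(2)]])

lemma sphere_union_image:
  assumes "sphere comparable n F" "\<And>a. a \<in> F \<Longrightarrow> a \<inter> x = {}"
  shows "sphere comparable n ((\<union>) x ` F)"
  by (rule sphere_image[OF assms(1) inj_on_union_image[OF assms(2)]
        comparable_union_iff[OF assms(2)]])

section \<open>The part of a simplex that carries all its colours\<close>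

lemma image_remove_repeated:
  assumes "b \<in> x" "a \<noteq> b" "f a = f b"
  shows "f ` (x - {a}) = f ` x"
proof (intro subset_antisym subsetI)
  fix c assume "c \<in> f ` x"
  then obtain u where u: "u \<in> x" "c = f u" by auto
  show "c \<in> f ` (x - {a})"
  proof (cases "u = a")
    case True
    then have "c = f b" using u(2) assms(3) by simp
    then show ?thesis using assms(1,2) by simp
  qed (use u in simp)
qed auto

text \<open>
  The family is the face poset of the boundary of a product of simplices, one for each colour
  class. For a constant colouring it is the refined boundary of a single simplex.

  If every colour occurs once, the family is empty. Otherwise, below a member \<open>z\<close> the statement
  repeats with the smaller set \<open>z\<close>, and between \<open>z\<close> and \<open>y\<close> it is the constant colouring of
  \<open>y - z\<close>; the two are joined. For the contraction take \<open>v\<close> and \<open>w\<close> of the same colour and delete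
  the facet \<open>y - {v}\<close>. Now \<open>v\<close> can be inserted everywhere without reaching \<open>y\<close>, and then \<open>w\<close> can be
  removed everywhere without losing its colour, since \<open>v\<close> has it too. What is left has the
  greatest member \<open>y - {w}\<close> and is a cone.
\<close>

lemma sphere_colourful_below:
  fixes f :: "'a \<Rightarrow> 'c"
  assumes "finite y" "y \<noteq> {}"
  shows "sphere comparable (int (card y) - int (card (f ` y)) - 1) {z. z \<subset> y \<and> f ` z = f ` y}"
  using assms
proof (induction y arbitrary: f rule: finite_psubset_induct)
  case (psubset y)
  let ?F = "{z. z \<subset> y \<and> f ` z = f ` y}"
  have finF: "finite ?F"
    by (rule finite_subset[of _ "Pow y"]) (use psubset.hyps in auto)
  have fin: "finite z" if "z \<in> ?F" for z
    using that psubset.hyps finite_subset[of z y] by auto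
  show ?case
  proof (cases "inj_on f y")
    case True
    then have "?F = {}" by (auto dest: inj_on_image_eq_iff)
    moreover have "card (f ` y) = card y" using True by (rule card_image)
    ultimately show ?thesis by (simp only:) (simp add: sphere.empty)
  next
    case False
    then obtain v w where vw: "v \<in> y" "w \<in> y" "v \<noteq> w" "f v = f w"
      by (auto simp: inj_on_def)
    have "0 \<le> int (card y) - int (card (f ` y)) - 1"
      using False psubset.hyps card_image_le[of y f] eq_card_imp_inj_on[of y f] by force
    moreover have "sphere comparable (int (card y) - int (card (f ` y)) - 1 - 1) (nbrs comparable ?F z)"
      if z: "z \<in> ?F" for z
    proof -
      have z': "z \<subset> y" "f ` z = f ` y" "z \<noteq> {}" "finite z" using z fin psubset.prems by auto
      have 1: "sphere comparable (int (card z) - int (card (f ` y)) - 1) {u. u \<subset> z \<and> f ` u = f ` y}"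
        using psubset.IH[of z f] z' by simp
      \<comment> \<open>under a constant colouring the members below \<open>y - z\<close> are all its proper non-empty subsets\<close>
      let ?c = "\<lambda>_. undefined :: 'c" and ?U = "{u. u \<subset> y - z \<and> u \<noteq> {}}"
      have "{u. u \<subset> y - z \<and> ?c ` u = ?c ` (y - z)} = ?U" "card (?c ` (y - z)) = 1"
        using z' by (auto simp: image_constant_conv)
      moreover have "card (y - z) = card y - card z" "card z < card y"
        using z' psubset.hyps by (auto simp: card_Diff_subset psubset_card_mono)
      ultimately have "sphere comparable (int (card y) - int (card z) - 2) ?U"
        using psubset.IH[of "y - z" ?c] z' by (auto simp: of_nat_diff)
      moreover have "\<And>a. a \<in> ?U \<Longrightarrow> a \<inter> z = {}" by auto
      ultimately have 2: "sphere comparable (int (card y) - int (card z) - 2) ((\<union>) z ` ?U)"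
        by (rule sphere_union_image)
      have eq: "(\<union>) z ` ?U = {u. z \<subset> u \<and> u \<subset> y}"
      proof (intro subset_antisym subsetI)
        fix u assume "u \<in> {u. z \<subset> u \<and> u \<subset> y}"
        then have "u = z \<union> (u - z)" "u - z \<in> ?U" by auto
        then show "u \<in> (\<union>) z ` ?U" by blast
      qed (use z' in auto)
      have between: "f ` u = f ` y" if "z \<subset> u" "u \<subset> y" for u
        using that z'(2) image_mono[of z u f] image_mono[of u y f] by auto
      have "u \<in> nbrs comparable ?F z \<longleftrightarrow> u \<subset> z \<and> f ` u = f ` y \<or> z \<subset> u \<and> u \<subset> y" for u
        unfolding nbrs_def comparable_def mem_Collect_eq
        using between[of u] psubset_trans[OF _ z'(1), of u] by satx
      then have "nbrs comparable ?F z = {u. u \<subset> z \<and> f ` u = f ` y} \<union> {u. z \<subset> u \<and> u \<subset> y}"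
        by (intro set_eqI) (simp only: Un_iff mem_Collect_eq)
      moreover have "sphere comparable
          (int (card z) - int (card (f ` y)) - 1 + (int (card y) - int (card z) - 2) + 1)
          ({u. u \<subset> z \<and> f ` u = f ` y} \<union> {u. z \<subset> u \<and> u \<subset> y})"
        using 1 2[unfolded eq]
        by (rule comparable.sphere_join) (auto simp: comparable_def)
      ultimately show ?thesis by (simp add: algebra_simps)
    qed
    moreover have "y - {v} \<in> ?F" using vw image_remove_repeated[of w y v f] by auto
    moreover have "contractible comparable (?F - {y - {v}})"
    proof (rule contractible_insert_closed[of _ v])
      let ?X = "{x \<in> ?F - {y - {v}}. v \<in> x}"
      have X: "?X = {z. z \<subset> y \<and> f ` z = f ` y \<and> v \<in> z}" by auto
      show "contractible comparable ?X"
      proof (rule contractible_remove_closed[of _ w])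
        let ?Y = "{x \<in> ?X. w \<notin> x}"
        have "y - {w} \<in> ?Y" using vw image_remove_repeated[of v y w f] by auto
        moreover have "x \<subset> y - {w}" if "x \<in> ?Y - {y - {w}}" for x
          using that by auto
        moreover have "finite (?Y - {y - {w}})"
          by (rule finite_subset[OF _ finF]) blast
        ultimately have "contractible comparable (insert (y - {w}) (?Y - {y - {w}}))"
          by (intro comparable.contractible_cone[of _ "y - {w}"]) (auto simp: comparable_def)
        then show "contractible comparable ?Y"
          using \<open>y - {w} \<in> ?Y\<close> by (simp add: insert_absorb)
        show "x - {w} \<in> ?X" if "x \<in> ?X" for x
        proof -
          have "f ` (x - {w}) = f ` x" using that vw image_remove_repeated[of v x w f] by auto
          then show ?thesis using that vw unfolding X by auto
        qed
        show "finite ?X" by (rule finite_subset[OF _ finF]) blast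
      qed (use fin in auto)
      show "insert v x \<in> ?F - {y - {v}}" if "x \<in> ?F - {y - {v}}" for x
        using that vw by auto
      show "finite (?F - {y - {v}})" using finF by (rule finite_Diff)
    qed (use fin in auto)
    ultimately show ?thesis by (rule sphere.nonempty)
  qed
qed

section \<open>Barycentric refinement\<close>

definition simplices :: "('a \<Rightarrow> 'a \<Rightarrow> bool) \<Rightarrow> 'a set \<Rightarrow> 'a set set" where
  "simplices E V = {x. x \<noteq> {} \<and> x \<subseteq> V \<and> pairwise E x}"

context adjacency
begin

lemma finite_simplices: "finite V \<Longrightarrow> finite (simplices E V)"
  by (rule finite_subset[of _ "Pow V"]) (auto simp: simplices_def)

lemma finite_simplex: "finite V \<Longrightarrow> x \<in> simplices E V \<Longrightarrow> finite x"
  by (auto simp: simplices_def intro: finite_subset)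

text \<open>
  What a larger simplex adds to \<open>y\<close> is again a simplex, and its vertices are adjacent to all of
  \<open>y\<close>; so the part above \<open>y\<close> is a copy of the barycentric refinement of the link.
\<close>

lemma simplices_above:
  assumes "y \<in> simplices E V"
  shows "{z \<in> simplices E V. y \<subset> z} = (\<union>) y ` simplices E (link V y)"
proof (intro subset_antisym subsetI)
  fix z assume "z \<in> {z \<in> simplices E V. y \<subset> z}"
  then have z: "y \<subset> z" "z \<subseteq> V" "pairwise E z" by (auto simp: simplices_def)
  have "E u w" if "w \<in> z - y" "u \<in> y" for u w
    using that z by (auto intro: pairwiseD)
  then have "z - y \<subseteq> link V y" using z by (auto simp: link_def)
  moreover have "z - y \<noteq> {}" "pairwise E (z - y)" "z = y \<union> (z - y)"
    using z by (auto intro: pairwise_subset)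
  ultimately have "z = y \<union> (z - y)" "z - y \<in> simplices E (link V y)"
    by (simp_all add: simplices_def)
  then show "z \<in> (\<union>) y ` simplices E (link V y)" by blast
next
  fix z assume "z \<in> (\<union>) y ` simplices E (link V y)"
  then obtain u where u: "u \<in> simplices E (link V y)" "z = y \<union> u" by auto
  obtain a where "a \<in> u" using u by (auto simp: simplices_def)
  then have "a \<notin> y" using u irrefl by (auto simp: simplices_def link_def)
  moreover have "E p q" if "p \<in> y \<union> u" "q \<in> y \<union> u" "p \<noteq> q" for p q
  proof -
    have y: "pairwise E y" and u: "pairwise E u" and yu: "\<And>a b. a \<in> y \<Longrightarrow> b \<in> u \<Longrightarrow> E a b"
      using u(1) assms by (auto simp: simplices_def link_def)
    show ?thesis
      using that pairwiseD[OF y, of p q] pairwiseD[OF u, of p q] yu[of p q] sym[OF yu[of q p]]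
      by blast
  qed
  then have "pairwise E (y \<union> u)" by (rule pairwiseI)
  ultimately show "z \<in> {z \<in> simplices E V. y \<subset> z}"
    using u \<open>a \<in> u\<close> assms by (auto simp: simplices_def link_def)
qed

lemma simplices_link_disjoint: "u \<in> simplices E (link V y) \<Longrightarrow> u \<inter> y = {}"
  using irrefl by (auto simp: simplices_def link_def)

text \<open>
  Without the simplex \<open>{v}\<close>, the vertex \<open>v\<close> can be removed from every simplex that contains it,
  without reaching the empty set.
\<close>

lemma contractible_simplices_remove_vertex:
  assumes "finite V" "contractible comparable (simplices E (V - {v}))"
  shows "contractible comparable (simplices E V - {{v}})"
proof (rule contractible_remove_closed[of _ v])
  have "{x \<in> simplices E V - {{v}}. v \<notin> x} = simplices E (V - {v})"
    by (auto simp: simplices_def)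
  then show "contractible comparable {x \<in> simplices E V - {{v}}. v \<notin> x}"
    using assms(2) by simp
  show "x - {v} \<in> simplices E V - {{v}}" if "x \<in> simplices E V - {{v}}" for x
    using that by (auto simp: simplices_def pairwise_def)
  show "finite x" if "x \<in> simplices E V - {{v}}" for x
    using that finite_simplex[OF assms(1)] by simp
qed (use finite_simplices[OF assms(1)] in simp)

text \<open>
  The simplices comparable to \<open>{v}\<close> arise from the refinement of the unit sphere of \<open>v\<close> by adding
  \<open>v\<close>, and the family without \<open>{v}\<close> contracts to the refinement of \<open>V - {v}\<close>. Each step of a
  contraction of \<open>V\<close> can thus be copied.
\<close>

lemma contractible_simplices:
  assumes "contractible E V"
  shows "contractible comparable (simplices E V)"
  using assms
proof (induction rule: contractible.induct)
  case (point v)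
  have "simplices E {v} = {{v}}" by (auto simp: simplices_def)
  then show ?case by (simp add: contractible.point)
next
  case (extend v V)
  have v: "{v} \<in> simplices E V" using extend.hyps by (simp add: simplices_def)
  have fin: "finite V" using contractible_finite[OF extend.hyps(3)] by simp
  have "nbrs comparable (simplices E V) {v} = {z \<in> simplices E V. {v} \<subset> z}"
    by (auto simp: nbrs_def comparable_def simplices_def)
  also have "\<dots> = (\<union>) {v} ` simplices E (link V {v})"
    using v by (rule simplices_above)
  finally have "nbrs comparable (simplices E V) {v} = (\<union>) {v} ` simplices E (nbrs E V v)"
    by (simp add: link_def nbrs_def)
  moreover have "\<And>u. u \<in> simplices E (nbrs E V v) \<Longrightarrow> u \<inter> {v} = {}"
    using irrefl by (auto simp: simplices_def nbrs_def)
  then have "contractible comparable ((\<union>) {v} ` simplices E (nbrs E V v))"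
    by (rule contractible_union_image[OF extend.IH(1)])
  ultimately have "contractible comparable (nbrs comparable (simplices E V) {v})"
    by simp
  then show ?case
    using contractible_simplices_remove_vertex[OF fin extend.IH(2)]
    by (rule contractible.extend[OF v])
qed

text \<open>
  The unit sphere of \<open>y\<close> is the join of the part below with the part above, where the condition on
  the colours is automatic.
\<close>

lemma sphere_colourful_nbrs:
  fixes f :: "'a \<Rightarrow> 'c"
  assumes "finite V" "y \<in> simplices E V" "f ` y = f ` V"
    and "sphere comparable n (simplices E (link V y))"
  shows "sphere comparable (n + int (card y) - int (card (f ` V)))
    (nbrs comparable {z \<in> simplices E V. f ` z = f ` V} y)"
proof -
  have y: "finite y" "y \<noteq> {}" "y \<subseteq> V"
    using finite_simplex[OF assms(1,2)] assms(2) by (simp_all add: simplices_def)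
  let ?lower = "{z. z \<subset> y \<and> f ` z = f ` V}" and ?upper = "{z \<in> simplices E V. y \<subset> z}"
  have "sphere comparable n ((\<union>) y ` simplices E (link V y))"
    using assms(4) simplices_link_disjoint by (rule sphere_union_image)
  then have upper: "sphere comparable n ?upper"
    using simplices_above[OF assms(2)] by simp
  have "sphere comparable (int (card y) - int (card (f ` V)) - 1) ?lower"
    using sphere_colourful_below[OF y(1,2), of f] assms(3) by simp
  then have "sphere comparable (int (card y) - int (card (f ` V)) - 1 + n + 1)
      (?lower \<union> ?upper)"
    using upper by (rule comparable.sphere_join) (auto simp: comparable_def)
  moreover have "nbrs comparable {z \<in> simplices E V. f ` z = f ` V} y = ?lower \<union> ?upper"
  proof -
    have sub: "f ` y \<noteq> {}" "pairwise E y" "y \<subseteq> V"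
      using y(2) assms(2) by (simp_all add: simplices_def)
    have lower: "z \<in> simplices E V" if "z \<subset> y" "f ` z = f ` V" for z
    proof -
      have "z \<noteq> {}" using that(2) assms(3) sub(1) by auto
      moreover have "z \<subseteq> V" "pairwise E z"
        using that(1) sub(2,3) pairwise_subset[OF sub(2), of z] by auto
      ultimately show ?thesis by (simp add: simplices_def)
    qed
    have above: "f ` z = f ` V" if "z \<in> simplices E V" "y \<subset> z" for z
    proof
      show "f ` z \<subseteq> f ` V" using that(1) by (auto simp: simplices_def)
      show "f ` V \<subseteq> f ` z" using that(2) assms(3) image_mono[of y z f] by simp
    qed
    have "z \<in> nbrs comparable {z \<in> simplices E V. f ` z = f ` V} y \<longleftrightarrow>
        z \<in> ?lower \<union> ?upper" for z
      unfolding nbrs_def comparable_def mem_Collect_eq Un_iff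
      using lower[of z] above[of z] by satx
    then show ?thesis by (rule set_eqI)
  qed
  ultimately show ?thesis by (simp add: algebra_simps)
qed

text \<open>
  Barycentric refinement is the case of a single colour. The induction runs over the vertex set
  and not over the derivation of \<open>sphere\<close>, because it is applied to links, which are several
  unit spheres deep.
\<close>

lemma sphere_simplices:
  assumes "sphere E n V"
  shows "sphere comparable n (simplices E V)"
  using sphere_finite[OF assms] assms
proof (induction V arbitrary: n rule: finite_psubset_induct)
  case (psubset V)
  from psubset.prems show ?case
  proof (cases rule: sphere.cases)
    case empty
    then have "simplices E V = {}" by (auto simp: simplices_def)
    then show ?thesis using empty by (simp add: sphere.empty)
  next
    case (nonempty v)
    \<comment> \<open>with a single colour, every simplex carries all colours\<close>
    let ?f = "\<lambda>_ :: 'a. True"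
    show ?thesis
    proof (rule sphere.nonempty)
      show "sphere comparable (n - 1) (nbrs comparable (simplices E V) y)"
        if y: "y \<in> simplices E V" for y
      proof -
        have y': "finite y" "y \<noteq> {}" "y \<subseteq> V" "pairwise E y"
          using finite_simplex[OF psubset.hyps y] y by (simp_all add: simplices_def)
        have "link V y \<subset> V"
          using y' irrefl by (auto simp: link_def)
        then have "sphere comparable (n - int (card y)) (simplices E (link V y))"
          using sphere_link[OF sphere_manifold[OF psubset.prems] y'(1,2,3,4)] by (rule psubset.IH)
        moreover have "?f ` y = ?f ` V"
          using y'(2,3) by auto
        ultimately have "sphere comparable (n - int (card y) + int (card y) - int (card (?f ` V)))
            (nbrs comparable {z \<in> simplices E V. ?f ` z = ?f ` V} y)"
          by (intro sphere_colourful_nbrs[OF psubset.hyps y])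
        moreover have "{z \<in> simplices E V. ?f ` z = ?f ` V} = simplices E V"
          using y'(2,3) by (auto simp: simplices_def)
        moreover have "card (?f ` V) = 1"
        proof -
          have "V \<noteq> {}" using y'(2,3) by auto
          then show ?thesis by (simp add: image_constant_conv)
        qed
        ultimately show ?thesis by simp
      qed
      show "{v} \<in> simplices E V"
        using nonempty by (simp add: simplices_def)
      show "contractible comparable (simplices E V - {{v}})"
        using psubset.hyps contractible_simplices[OF nonempty(4)]
        by (rule contractible_simplices_remove_vertex)
    qed (rule nonempty(1))
  qed
qed

theorem manifold_colourful_simplices:
  assumes "finite V" "manifold E n V"
  shows "manifold comparable (n + 1 - int (card (f ` V))) {y \<in> simplices E V. f ` y = f ` V}"
  unfolding manifold_def
proof
  fix y assume "y \<in> {y \<in> simplices E V. f ` y = f ` V}"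
  then have y: "y \<in> simplices E V" "f ` y = f ` V" by simp_all
  from y(1) have "y \<noteq> {}" "y \<subseteq> V" "pairwise E y"
    unfolding simplices_def by simp_all
  with finite_simplex[OF assms(1) y(1)] have "sphere E (n - int (card y)) (link V y)"
    by (rule sphere_link[OF assms(2)])
  note sphere_colourful_nbrs[OF assms(1) y sphere_simplices[OF this]]
  moreover have "n - int (card y) + int (card y) - int (card (f ` V))
      = n + 1 - int (card (f ` V)) - 1"
    by simp
  ultimately
  show "sphere comparable (n + 1 - int (card (f ` V)) - 1)
      (nbrs comparable {y \<in> simplices E V. f ` y = f ` V} y)"
    by (simp only:)
qed

end

section \<open>Graphs as sets with an adjacency relation\<close>

text \<open>
  Unit spheres and deletions are computed inside one relation \<open>E\<close> on both sides, so \<open>E\<close> has to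
  agree with adjacency only on the vertices of the graph. The notions for graphs and for vertex
  sets then determine each other.
\<close>

definition represents ::
    "('a, 'b) pre_digraph \<Rightarrow> ('a \<Rightarrow> 'a \<Rightarrow> bool) \<Rightarrow> 'a set \<Rightarrow> bool" where
  "represents G E V \<longleftrightarrow>
    graph G \<and> verts G = V \<and> (\<forall>u \<in> V. \<forall>w \<in> V. u \<rightarrow>\<^bsub>G\<^esub> w \<longleftrightarrow> E u w)"

lemma adj_induce_subgraph: "u \<rightarrow>\<^bsub>G \<restriction> S\<^esub> w \<longleftrightarrow> u \<in> S \<and> w \<in> S \<and> u \<rightarrow>\<^bsub>G\<^esub> w"
  by (auto simp: arcs_ends_def arc_to_ends_def)

lemma represents_induce_subgraph:
  assumes "represents G E V" "S \<subseteq> V"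
  shows "represents (G \<restriction> S) E S"
  using assms graph_induce_subgraph[of G S]
  by (auto simp: represents_def adj_induce_subgraph)

lemma represents_unit_sphere:
  assumes "represents G E V" "v \<in> V"
  shows "represents (unit_sphere G v) E (nbrs E V v)"
proof -
  interpret graph G using assms by (simp add: represents_def)
  have "v \<rightarrow>\<^bsub>G\<^esub> w \<longleftrightarrow> w \<in> V \<and> E v w" for w
    using assms adj_in_verts(2)[of v w] by (auto simp: represents_def)
  then have "{w. v \<rightarrow>\<^bsub>G\<^esub> w} = nbrs E V v"
    by (simp add: nbrs_def)
  then show ?thesis
    using represents_induce_subgraph[OF assms(1), of "nbrs E V v"]
    by (simp add: unit_sphere_def nbrs_def)
qed

lemma represents_del_vert:
  assumes "represents G E V"
  shows "represents (pre_digraph.del_vert G v) E (V - {v})"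
  using represents_induce_subgraph[OF assms, of "V - {v}"] assms
  by (simp add: represents_def del_vert_eq_induce_subgraph)

lemma contractible_of_graph:
  "contractible_graph G \<Longrightarrow> represents G E V \<Longrightarrow> contractible E V"
proof (induction arbitrary: V rule: contractible_graph.induct)
  case (one_vertex G v)
  then have "V = {v}" by (simp add: represents_def)
  then show ?case by (simp add: contractible.point)
next
  case (extend v G)
  then have v: "v \<in> V" by (simp add: represents_def)
  then show ?case
    using extend.IH(1)[OF represents_unit_sphere[OF extend.prems v]]
      extend.IH(2)[OF represents_del_vert[OF extend.prems]]
    by (rule contractible.extend)
qed

lemma contractible_graph_of_set:
  "contractible E V \<Longrightarrow> represents G E V \<Longrightarrow> contractible_graph G"
proof (induction arbitrary: G rule: contractible.induct)
  case (point v)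
  then show ?case using contractible_graph.one_vertex[of G v] by (simp add: represents_def)
next
  case (extend v V)
  then have "v \<in> verts G" by (simp add: represents_def)
  then show ?case
    using extend.IH(1)[OF represents_unit_sphere[OF extend.prems extend.hyps(1)]]
      extend.IH(2)[OF represents_del_vert[OF extend.prems]]
    by (rule contractible_graph.extend)
qed

lemma manifold_sphere_of_graph:
  "d_manifold d G \<Longrightarrow> (\<forall>V. represents G E V \<longrightarrow> manifold E d V)"
  "d_sphere d G \<Longrightarrow> (\<forall>V. represents G E V \<longrightarrow> sphere E d V)"
proof (induction rule: d_manifold_d_sphere.inducts)
  case (manifold G d)
  then show ?case
    unfolding manifold_def by (metis represents_def represents_unit_sphere)
next
  case (empty_sphere G)
  then show ?case by (simp add: represents_def sphere.empty)
next
  case (sphere d G v)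
  show ?case
  proof (intro allI impI)
    fix V assume V: "represents G E V"
    then have "manifold E d V" using sphere by blast
    moreover have "contractible E (V - {v})"
      using contractible_of_graph[OF sphere(4) represents_del_vert[OF V]] .
    moreover have "v \<in> V" using sphere V by (simp add: represents_def)
    ultimately show "sphere E d V"
      using sphere(1) sphere.nonempty[of d V E v] unfolding manifold_def by blast
  qed
qed

lemma d_sphere_of_set:
  "sphere E n V \<Longrightarrow> represents G E V \<Longrightarrow> d_sphere n G"
proof (induction arbitrary: G rule: sphere.induct)
  case empty
  then show ?case using empty_sphere[of G] by (simp add: represents_def)
next
  case (nonempty n V v)
  have V: "verts G = V" using nonempty.prems by (simp add: represents_def)
  have "d_manifold n G"
    using nonempty.IH represents_unit_sphere[OF nonempty.prems] V
    by (blast intro: d_manifold_d_sphere.manifold)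
  then show ?case
    using d_manifold_d_sphere.sphere[of n G v] nonempty.hyps(1,3) V
      contractible_graph_of_set[OF nonempty.hyps(4) represents_del_vert[OF nonempty.prems]]
    by blast
qed

lemma d_manifold_of_set:
  assumes "manifold E n V" "represents G E V"
  shows "d_manifold n G"
proof (rule d_manifold_d_sphere.manifold)
  fix v assume "v \<in> verts G"
  then have "v \<in> V" using assms by (simp add: represents_def)
  then show "d_sphere (n - 1) (unit_sphere G v)"
    using assms(1) d_sphere_of_set[OF _ represents_unit_sphere[OF assms(2)]]
    by (simp add: manifold_def)
qed

lemma adjacency_dominates: "graph G \<Longrightarrow> adjacency (\<lambda>u w. u \<rightarrow>\<^bsub>G\<^esub> w)"
proof -
  assume "graph G"
  then interpret graph G .
  show ?thesis
    using sym_arcs adj_not_same by unfold_locales (auto simp: symmetric_def dest: symD)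
qed

lemma represents_barycentric_refinement:
  assumes "graph G"
  shows "represents (barycentric_refinement G) comparable
    (simplices (\<lambda>u w. u \<rightarrow>\<^bsub>G\<^esub> w) (verts G))"
proof -
  have "simplices (\<lambda>u w. u \<rightarrow>\<^bsub>G\<^esub> w) (verts G) = {x. simplex G x}"
    by (auto simp: simplices_def simplex_def pairwise_def)
  moreover have "x \<rightarrow>\<^bsub>barycentric_refinement G\<^esub> y \<longleftrightarrow>
      simplex G x \<and> simplex G y \<and> comparable x y" for x y
    by (auto simp: barycentric_refinement_def comparable_def arcs_ends_def arc_to_ends_def)
  ultimately show ?thesis
    using graph_barycentric_refinement[OF assms]
    by (simp add: represents_def barycentric_refinement_def)
qed

section \<open>Level surfaces\<close>

definition colour :: "complex \<Rightarrow> nat" where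
  "colour z = (if csign z = -1 + \<i> then 0 else if csign z = 1 - \<i> then 1 else 2)"

text \<open>
  Three signs that include both special ones are these two and one more, that is, all three
  colours. Conversely, vertices of the three colours have different signs, so they are distinct
  and span a triangle.
\<close>

lemma contains_crossing_triangle_iff:
  assumes "simplex G y"
  shows "(\<exists>x. x \<subseteq> y \<and> triangle G x \<and> card ((\<lambda>v. csign (\<psi> v - c)) ` x) \<ge> 3 \<and>
      {-1 + \<i>, 1 - \<i>} \<subseteq> (\<lambda>v. csign (\<psi> v - c)) ` x) \<longleftrightarrow>
    (\<lambda>v. colour (\<psi> v - c)) ` y = {0, 1, 2}"
    (is "?L \<longleftrightarrow> ?k ` y = _")
proof -
  let ?s = "\<lambda>v. csign (\<psi> v - c)"
  let ?a = "-1 + \<i>" and ?b = "1 - \<i>"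
  have ne: "?a \<noteq> ?b" by (simp add: complex_eq_iff)
  have k: "?k v = 0 \<longleftrightarrow> ?s v = ?a" "?k v = 1 \<longleftrightarrow> ?s v = ?b"
      "?k v = 2 \<longleftrightarrow> ?s v \<noteq> ?a \<and> ?s v \<noteq> ?b" for v
    unfolding colour_def using ne by (simp_all split: if_split)
  show ?thesis
  proof
    assume ?L
    then obtain x where x: "x \<subseteq> y" "card (?s ` x) \<ge> 3" "{?a, ?b} \<subseteq> ?s ` x"
      by blast
    have "\<not> ?s ` x \<subseteq> {?a, ?b}"
    proof
      assume "?s ` x \<subseteq> {?a, ?b}"
      then have "card (?s ` x) \<le> card {?a, ?b}" by (rule card_mono[rotated]) simp
      then show False using x(2) ne by simp
    qed
    then have "2 \<in> ?k ` x" using k(3) by (auto simp: image_iff)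
    moreover have "0 \<in> ?k ` x" "1 \<in> ?k ` x"
      using x(3) k(1,2) by (simp_all only: insert_subset) (force simp: image_iff)+
    moreover have "?k ` x \<subseteq> ?k ` y" using x(1) by (rule image_mono)
    ultimately have "{0, 1, 2} \<subseteq> ?k ` y" by blast
    moreover have "?k ` y \<subseteq> {0, 1, 2}" by (auto simp: colour_def)
    ultimately show "?k ` y = {0, 1, 2}" by (rule subset_antisym[rotated])
  next
    assume "?k ` y = {0, 1, 2}"
    then have img_k: "0 \<in> ?k ` y" "1 \<in> ?k ` y" "2 \<in> ?k ` y" by simp_all
    from img_k(1) obtain u where u: "u \<in> y" "?s u = ?a" unfolding image_iff using k(1) by metis
    from img_k(2) obtain v where v: "v \<in> y" "?s v = ?b" unfolding image_iff using k(2) by metis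
    from img_k(3) obtain w where w: "w \<in> y" "?s w \<noteq> ?a" "?s w \<noteq> ?b"
      unfolding image_iff using k(3) by metis
    have ?L if "x = {u, v, w}" for x
    proof (intro exI conjI)
      show "x \<subseteq> y" using that u(1) v(1) w(1) by simp
      have "simplex G x"
        using assms \<open>x \<subseteq> y\<close> that unfolding simplex_def by blast
      moreover have "u \<noteq> v" "u \<noteq> w" "v \<noteq> w" using u(2) v(2) w(2,3) ne by auto
      then have "card x = 3" using that by simp
      ultimately show "triangle G x" by (simp add: triangle_def)
      have img: "?s ` x = {?a, ?b, ?s w}" using that u(2) v(2) by simp
      have "card {?a, ?b, ?s w} = 3"
        using ne w(2,3)[symmetric] by simp
      then show "card (?s ` x) \<ge> 3" by (simp only: img)
      show "{?a, ?b} \<subseteq> ?s ` x" unfolding img by blast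
    qed
    then show ?L by blast
  qed
qed

theorem theorem2:
  fixes d :: nat
    and G :: "('a, 'b) pre_digraph"
    and \<psi> :: "'a \<Rightarrow> complex"
    and c :: complex
  assumes "graph G"
    and "d_manifold (int d) G"
    and "c \<notin> \<psi> ` verts G"
  shows "d_manifold (int d - 2) (level_surface G \<psi> c) \<or> verts (level_surface G \<psi> c) = {}"
proof -
  let ?E = "\<lambda>u w. u \<rightarrow>\<^bsub>G\<^esub> w" and ?V = "verts G" and ?k = "\<lambda>v. colour (\<psi> v - c)"
  interpret G: graph G by fact
  interpret adjacency ?E using assms(1) by (rule adjacency_dominates)
  let ?S = "{y \<in> simplices ?E ?V. ?k ` y = {0, 1, 2}}"
  have simplex: "simplex G y \<longleftrightarrow> y \<in> simplices ?E ?V" for y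
    by (auto simp: simplices_def simplex_def pairwise_def)
  have level: "level_surface G \<psi> c = barycentric_refinement G \<restriction> ?S"
    unfolding level_surface_def simplex[symmetric]
    using contains_crossing_triangle_iff[of G]
    by (intro arg_cong[where f = "induce_subgraph _"] Collect_cong conj_cong) auto
  show ?thesis
  proof (cases "?k ` ?V = {0, 1, 2}")
    case True
    have "represents G ?E ?V" using assms(1) by (simp add: represents_def)
    then have "manifold ?E (int d) ?V"
      using manifold_sphere_of_graph(1)[OF assms(2)] by blast
    then have "manifold comparable (int d - 2) ?S"
      using manifold_colourful_simplices[OF G.finite_verts, of "int d" ?k] True by simp
    moreover have "represents (level_surface G \<psi> c) comparable ?S"
      unfolding level
      by (rule represents_induce_subgraph[OF represents_barycentric_refinement[OF assms(1)]]) auto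
    ultimately show ?thesis using d_manifold_of_set by blast
  next
    case False
    have "?k ` ?V \<subseteq> {0, 1, 2}" by (auto simp: colour_def)
    then have "?S = {}"
      using False by (auto simp: simplices_def dest: image_mono[of _ ?V ?k])
    then show ?thesis by (simp add: level)
  qed
qed

end
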